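(* Let $n\ge 5$ and let $W(n+1,n,1)$ be an $(n+1)$-web of codimension one on an $n$-dimensional manifold $X^n$, with torsion tensor $a_{\alpha\beta}$ (as defined in the context), which is a Goursat web of the second kind. Let $\Delta_4$ be the four-dimensional distribution defined by $$(a_{14}-a_{13})\,\omega_4+(a_{15}-a_{13})\,\omega_5=0,\qquad \omega_\sigma=0,\ \ \sigma=6,\dots,n,$$ and let $\Delta_2$ be the two-dimensional distribution defined by $$\omega_1+\omega_2=0,\quad \omega_3+\omega_4+\omega_5=0,\quad a_{13}\omega_3+a_{14}\omega_4+a_{15}\omega_5=0,\quad a_{23}\omega_3+a_{24}\omega_4+a_{25}\omega_5=0,\quad \omega_\sigma=0,\ \ \sigma=6,\dots,n.$$ If $\Delta_4$ is integrable, then $\Delta_2$ is integrable.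
   Context: An $(n+1)$-web $W(n+1,n,1)$ on an $n$-dimensional differentiable manifold $X^n$ consists of $n+1$ foliations of codimension one, the $\xi$-th one ($\xi=1,\dots,n+1$) given by a completely integrable Pfaffian equation $\omega_\xi=0$, in general position: any $n$ of the $1$-forms $\omega_\xi$ are linearly independent at every point. The forms are normalized (by scaling) so that $\omega_1+\dots+\omega_{n+1}=0$; $\omega_1,\dots,\omega_n$ form a coframe. They satisfy the structure equations $$d\omega_\alpha=\omega_\alpha\wedge\omega+\sum_{\beta\ne\alpha}a_{\alpha\beta}\,\omega_\alpha\wedge\omega_\beta,\qquad \alpha,\beta=1,\dots,n,$$ where $\omega$ is a $1$-form and $a_{\alpha\beta}$ are functions (the torsion tensor) with $a_{\alpha\beta}=a_{\beta\alpha}$ and $\sum_{\alpha,\beta=1}^n a_{\alpha\beta}=0$; by convention $a_{\alpha\alpha}=0$. The web ($n\ge5$) is a Goursat web of the second kind if identically $$\begin{vmatrix}1&1&1\\ a_{13}&a_{14}&a_{15}\\ a_{23}&a_{24}&a_{25}\end{vmatrix}=0 .$$ Standing nondegeneracy assumption: the differences $a_{pa}-a_{pb}$ ($p=1,2$; $a,b\in\{3,4,5\}$, $a\ne b$) are nowhere zero, so that the determinant condition can equivalently be written as $\frac{a_{pa}-a_{pb}}{a_{pa}-a_{pc}}=\frac{a_{qa}-a_{qb}}{a_{qa}-a_{qc}}$ for $\{p,q\}=\{1,2\}$, $\{a,b,c\}=\{3,4,5\}$. "Integrable" means completely integrable in the sense of Frobenius. *)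

theory Defs
  imports "HOL-Analysis.Analysis"
begin

section \<open>Smooth manifolds and differential forms\<close>

fun Ck_on :: "nat \<Rightarrow> 'e::euclidean_space set \<Rightarrow> ('e \<Rightarrow> 'b::real_normed_vector) \<Rightarrow> bool" where
  "Ck_on 0 S f \<longleftrightarrow> continuous_on S f"
| "Ck_on (Suc k) S f \<longleftrightarrow> (\<forall>x\<in>S. f differentiable (at x)) \<and>
     (\<forall>v. Ck_on k S (\<lambda>x. frechet_derivative f (at x) v))"

text \<open>Only used for open \<open>S\<close>.\<close>
definition smooth_on :: "'e::euclidean_space set \<Rightarrow> ('e \<Rightarrow> 'b::real_normed_vector) \<Rightarrow> bool" where
  "smooth_on S f \<longleftrightarrow> (\<forall>k. Ck_on k S f)"

type_synonym ('a, 'e) chart = "'a set \<times> ('a \<Rightarrow> 'e)"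

definition chart_inv :: "('a, 'e) chart \<Rightarrow> 'e \<Rightarrow> 'a" where
  "chart_inv c = inv_into (fst c) (snd c)"

definition is_chart :: "'a topology \<Rightarrow> ('a, 'e::euclidean_space) chart \<Rightarrow> bool" where
  "is_chart X c \<longleftrightarrow> openin X (fst c) \<and> open (snd c ` fst c) \<and>
     homeomorphic_map (subtopology X (fst c)) (top_of_set (snd c ` fst c)) (snd c)"

definition transition :: "('a, 'e) chart \<Rightarrow> ('a, 'e) chart \<Rightarrow> 'e \<Rightarrow> 'e" where
  "transition c c' = snd c' \<circ> chart_inv c"

text \<open>\<open>X\<close> is an \<open>n\<close>-dimensional smooth manifold with the (not necessarily maximal) atlas \<open>A\<close>.\<close>
definition smooth_manifold ::
    "nat \<Rightarrow> 'a topology \<Rightarrow> ('a, 'e::euclidean_space) chart set \<Rightarrow> bool" where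
  "smooth_manifold n X A \<longleftrightarrow>
     DIM('e) = n \<and> Hausdorff_space X \<and> second_countable X \<and>
     (\<forall>c\<in>A. is_chart X c) \<and> (\<Union>c\<in>A. fst c) = topspace X \<and>
     (\<forall>c\<in>A. \<forall>c'\<in>A. smooth_on (snd c ` (fst c \<inter> fst c')) (transition c c'))"

definition smooth_function :: "('a, 'e::euclidean_space) chart set \<Rightarrow> ('a \<Rightarrow> real) \<Rightarrow> bool" where
  "smooth_function A f \<longleftrightarrow> (\<forall>c\<in>A. smooth_on (snd c ` fst c) (f \<circ> chart_inv c))"

text \<open>
  A 1-form is represented by its components: \<open>\<theta> c p\<close> is the covector at the point \<open>p\<close> in the
  coordinates of the chart \<open>c\<close>, and \<^term>\<open>frechet_derivative (transition c c') (at (snd c p))\<close>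
  translates tangent vectors at \<open>p\<close> from the coordinates of \<open>c\<close> to those of \<open>c'\<close>.
  Values at points outside the domain of \<open>c\<close> and for charts outside the atlas are irrelevant.
\<close>
type_synonym ('a, 'e) form1 = "('a, 'e) chart \<Rightarrow> 'a \<Rightarrow> 'e \<Rightarrow>\<^sub>L real"
type_synonym ('a, 'e) form2 = "('a, 'e) chart \<Rightarrow> 'a \<Rightarrow> 'e \<Rightarrow> 'e \<Rightarrow> real"

definition one_form ::
    "('a, 'e::euclidean_space) chart set \<Rightarrow> ('a, 'e) form1 \<Rightarrow> bool" where
  "one_form A \<theta> \<longleftrightarrow>
     (\<forall>c\<in>A. smooth_on (snd c ` fst c) (\<lambda>x. \<theta> c (chart_inv c x))) \<and>
     (\<forall>c\<in>A. \<forall>c'\<in>A. \<forall>p\<in>fst c \<inter> fst c'. \<forall>v.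
        blinfun_apply (\<theta> c p) v =
        blinfun_apply (\<theta> c' p) (frechet_derivative (transition c c') (at (snd c p)) v))"

definition wedge :: "('a, 'e::euclidean_space) form1 \<Rightarrow> ('a, 'e) form1 \<Rightarrow> ('a, 'e) form2" where
  "wedge \<theta> \<eta> c p u v =
     blinfun_apply (\<theta> c p) u * blinfun_apply (\<eta> c p) v -
     blinfun_apply (\<theta> c p) v * blinfun_apply (\<eta> c p) u"

definition ext_deriv :: "('a, 'e::euclidean_space) form1 \<Rightarrow> ('a, 'e) form2" where
  "ext_deriv \<theta> c p u v =
     blinfun_apply (frechet_derivative (\<lambda>x. \<theta> c (chart_inv c x)) (at (snd c p)) u) v -
     blinfun_apply (frechet_derivative (\<lambda>x. \<theta> c (chart_inv c x)) (at (snd c p)) v) u"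

section \<open>Pfaffian systems\<close>

text \<open>The tangent vectors at \<open>p\<close>, in the coordinates of \<open>c\<close>, on which all forms of \<open>\<Theta>\<close> vanish.\<close>
definition pfaff_dist ::
    "('a, 'e::euclidean_space) form1 set \<Rightarrow> ('a, 'e) chart \<Rightarrow> 'a \<Rightarrow> 'e set" where
  "pfaff_dist \<Theta> c p = {v. \<forall>\<theta>\<in>\<Theta>. blinfun_apply (\<theta> c p) v = 0}"

text \<open>
  Complete integrability in the sense of Frobenius: the equations \<open>\<theta> = 0\<close>, \<open>\<theta> \<in> \<Theta>\<close>, define a
  \<open>k\<close>-dimensional distribution, and every \<open>d\<theta>\<close> vanishes on it, that is, \<open>d\<theta> \<equiv> 0\<close> modulo
  \<open>\<Theta>\<close>. The forms in \<open>\<Theta>\<close> need not be linearly independent, which is why the condition is not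
  stated through the wedge product of all forms of \<open>\<Theta>\<close>.
\<close>
definition completely_integrable ::
    "('a, 'e::euclidean_space) chart set \<Rightarrow> nat \<Rightarrow> ('a, 'e) form1 set \<Rightarrow> bool" where
  "completely_integrable A k \<Theta> \<longleftrightarrow>
     (\<forall>c\<in>A. \<forall>p\<in>fst c.
        dim (pfaff_dist \<Theta> c p) = k \<and>
        (\<forall>\<theta>\<in>\<Theta>. \<forall>u\<in>pfaff_dist \<Theta> c p. \<forall>v\<in>pfaff_dist \<Theta> c p. ext_deriv \<theta> c p u v = 0))"

section \<open>Webs of codimension one\<close>

text \<open>
  An \<open>(n+1)\<close>-web given by normalized forms \<open>\<omega> 1, \<dots>, \<omega> (n+1)\<close>. In the general position
  condition, \<^const>\<open>inj_on\<close> makes linear independence that of the indexed family.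
\<close>
definition web ::
    "nat \<Rightarrow> ('a, 'e::euclidean_space) chart set \<Rightarrow> (nat \<Rightarrow> ('a, 'e) form1) \<Rightarrow> bool" where
  "web n A \<omega> \<longleftrightarrow>
     (\<forall>\<xi>\<in>{1..n+1}. one_form A (\<omega> \<xi>) \<and> completely_integrable A (n - 1) {\<omega> \<xi>}) \<and>
     (\<forall>c\<in>A. \<forall>p\<in>fst c. \<forall>J\<subseteq>{1..n+1}. card J = n \<longrightarrow>
        inj_on (\<lambda>\<xi>. \<omega> \<xi> c p) J \<and> independent ((\<lambda>\<xi>. \<omega> \<xi> c p) ` J)) \<and>
     (\<forall>c\<in>A. \<forall>p\<in>fst c. (\<Sum>\<xi>=1..n+1. \<omega> \<xi> c p) = 0)"

text \<open>\<open>a\<close> is the torsion tensor of the web, as determined by the structure equations.\<close>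
definition torsion_tensor ::
    "nat \<Rightarrow> ('a, 'e::euclidean_space) chart set \<Rightarrow> (nat \<Rightarrow> ('a, 'e) form1) \<Rightarrow>
     (nat \<Rightarrow> nat \<Rightarrow> 'a \<Rightarrow> real) \<Rightarrow> bool" where
  "torsion_tensor n A \<omega> a \<longleftrightarrow>
     (\<forall>\<alpha>\<in>{1..n}. \<forall>\<beta>\<in>{1..n}. smooth_function A (a \<alpha> \<beta>)) \<and>
     (\<forall>c\<in>A. \<forall>p\<in>fst c.
        (\<forall>\<alpha>\<in>{1..n}. a \<alpha> \<alpha> p = 0) \<and>
        (\<forall>\<alpha>\<in>{1..n}. \<forall>\<beta>\<in>{1..n}. a \<alpha> \<beta> p = a \<beta> \<alpha> p) \<and>
        (\<Sum>\<alpha>=1..n. \<Sum>\<beta>=1..n. a \<alpha> \<beta> p) = 0) \<and>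
     (\<exists>\<omega>\<^sub>0. one_form A \<omega>\<^sub>0 \<and>
        (\<forall>c\<in>A. \<forall>p\<in>fst c. \<forall>\<alpha>\<in>{1..n}. \<forall>u v.
           ext_deriv (\<omega> \<alpha>) c p u v =
           wedge (\<omega> \<alpha>) \<omega>\<^sub>0 c p u v +
           (\<Sum>\<beta>\<in>{1..n} - {\<alpha>}. a \<alpha> \<beta> p * wedge (\<omega> \<alpha>) (\<omega> \<beta>) c p u v)))"

definition goursat_second_kind :: "'a topology \<Rightarrow> (nat \<Rightarrow> nat \<Rightarrow> 'a \<Rightarrow> real) \<Rightarrow> bool" where
  "goursat_second_kind X a \<longleftrightarrow>
     (\<forall>p\<in>topspace X.
        det (vector [vector [1, 1, 1],
                     vector [a 1 3 p, a 1 4 p, a 1 5 p],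
                     vector [a 2 3 p, a 2 4 p, a 2 5 p]] :: real^3^3) = 0)"

definition goursat_nondegenerate :: "'a topology \<Rightarrow> (nat \<Rightarrow> nat \<Rightarrow> 'a \<Rightarrow> real) \<Rightarrow> bool" where
  "goursat_nondegenerate X a \<longleftrightarrow>
     (\<forall>p\<in>topspace X. \<forall>i\<in>{1, 2}. \<forall>j\<in>{3, 4, 5}. \<forall>k\<in>{3, 4, 5}.
        j \<noteq> k \<longrightarrow> a i j p - a i k p \<noteq> 0)"

definition Delta4 ::
    "nat \<Rightarrow> (nat \<Rightarrow> ('a, 'e::euclidean_space) form1) \<Rightarrow> (nat \<Rightarrow> nat \<Rightarrow> 'a \<Rightarrow> real) \<Rightarrow>
     ('a, 'e) form1 set" where
  "Delta4 n \<omega> a =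
     {\<lambda>c p. (a 1 4 p - a 1 3 p) *\<^sub>R \<omega> 4 c p + (a 1 5 p - a 1 3 p) *\<^sub>R \<omega> 5 c p} \<union> \<omega> ` {6..n}"

definition Delta2 ::
    "nat \<Rightarrow> (nat \<Rightarrow> ('a, 'e::euclidean_space) form1) \<Rightarrow> (nat \<Rightarrow> nat \<Rightarrow> 'a \<Rightarrow> real) \<Rightarrow>
     ('a, 'e) form1 set" where
  "Delta2 n \<omega> a =
     {\<lambda>c p. \<omega> 1 c p + \<omega> 2 c p,
      \<lambda>c p. \<omega> 3 c p + \<omega> 4 c p + \<omega> 5 c p,
      \<lambda>c p. a 1 3 p *\<^sub>R \<omega> 3 c p + a 1 4 p *\<^sub>R \<omega> 4 c p + a 1 5 p *\<^sub>R \<omega> 5 c p,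
      \<lambda>c p. a 2 3 p *\<^sub>R \<omega> 3 c p + a 2 4 p *\<^sub>R \<omega> 4 c p + a 2 5 p *\<^sub>R \<omega> 5 c p} \<union> \<omega> ` {6..n}"

end

theory Submission
  imports Defs
begin

text \<open>
  Put \<open>S = \<omega>\<^sub>3 + \<omega>\<^sub>4 + \<omega>\<^sub>5\<close> and \<open>H\<^sub>p = a\<^sub>p\<^sub>3 \<omega>\<^sub>3 + a\<^sub>p\<^sub>4 \<omega>\<^sub>4 + a\<^sub>p\<^sub>5 \<omega>\<^sub>5\<close> for \<open>p = 1, 2\<close>. On \<open>\<Delta>\<^sub>2\<close> the
  structure equations alone give \<open>d(\<omega>\<^sub>1 + \<omega>\<^sub>2) = dS = d\<omega>\<^sub>\<sigma> = 0\<close>. The form defining \<open>\<Delta>\<^sub>4\<close> is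
  \<open>K = H\<^sub>1 - a\<^sub>1\<^sub>3 S\<close>, so \<open>\<Delta>\<^sub>2\<close> is contained in \<open>\<Delta>\<^sub>4\<close> and integrability of \<open>\<Delta>\<^sub>4\<close> yields \<open>dH\<^sub>1 = 0\<close>
  on \<open>\<Delta>\<^sub>2\<close>. By the Goursat condition, \<open>H\<^sub>2\<close> is a combination of \<open>H\<^sub>1\<close> and \<open>S\<close> with functional
  coefficients, hence \<open>dH\<^sub>2 = 0\<close> on \<open>\<Delta>\<^sub>2\<close> as well.
\<close>

section \<open>Differentiability of functions and forms in a chart\<close>

lemma smooth_on_imp_differentiable:
  assumes "smooth_on S f" "x \<in> S"
  shows "f differentiable (at x)"
proof -
  have "Ck_on (Suc 0) S f" using assms(1) unfolding smooth_on_def by blast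
  then show ?thesis using assms(2) by simp
qed

lemma chart_inv_chart:
  assumes "is_chart X c" "p \<in> fst c"
  shows "chart_inv c (snd c p) = p"
proof -
  have "fst c \<subseteq> topspace X"
    "homeomorphic_map (subtopology X (fst c)) (top_of_set (snd c ` fst c)) (snd c)"
    using assms(1) openin_subset unfolding is_chart_def by blast+
  then have "inj_on (snd c) (fst c)"
    by (metis homeomorphic_eq_everything_map topspace_subtopology_subset)
  then show ?thesis unfolding chart_inv_def using assms(2) by simp
qed

text \<open>A notion at one point of one chart, so that forms combined from the
  \<open>\<omega> i\<close> with function coefficients inherit it from the rules for sums and
  products. It is what the calculus of \<open>ext_deriv\<close> below asks for.\<close>

definition differentiable_form ::
    "('a, 'e::euclidean_space) chart \<Rightarrow> 'a \<Rightarrow> ('a, 'e) form1 \<Rightarrow> bool" where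
  "differentiable_form c p \<theta> \<longleftrightarrow> (\<lambda>x. \<theta> c (chart_inv c x)) differentiable (at (snd c p))"

definition differentiable_function ::
    "('a, 'e::euclidean_space) chart \<Rightarrow> 'a \<Rightarrow> ('a \<Rightarrow> real) \<Rightarrow> bool" where
  "differentiable_function c p f \<longleftrightarrow> (\<lambda>x. f (chart_inv c x)) differentiable (at (snd c p))"

lemma one_form_differentiable:
  assumes "one_form A \<theta>" "c \<in> A" "p \<in> fst c"
  shows "differentiable_form c p \<theta>"
  using assms smooth_on_imp_differentiable
  unfolding one_form_def differentiable_form_def by blast

lemma smooth_function_differentiable:
  assumes "smooth_function A f" "c \<in> A" "p \<in> fst c"
  shows "differentiable_function c p f"
proof -
  have "(f \<circ> chart_inv c) differentiable (at (snd c p))"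
    using assms smooth_on_imp_differentiable unfolding smooth_function_def by blast
  then show ?thesis unfolding differentiable_function_def by (simp add: comp_def)
qed

lemma differentiable_function_diff:
  "differentiable_function c p f \<Longrightarrow> differentiable_function c p g \<Longrightarrow>
   differentiable_function c p (\<lambda>q. f q - g q)"
  unfolding differentiable_function_def by (rule differentiable_diff)

lemma differentiable_function_mult:
  "differentiable_function c p f \<Longrightarrow> differentiable_function c p g \<Longrightarrow>
   differentiable_function c p (\<lambda>q. f q * g q)"
  unfolding differentiable_function_def by (rule differentiable_mult)

lemma differentiable_form_add:
  "differentiable_form c p \<theta> \<Longrightarrow> differentiable_form c p \<eta> \<Longrightarrow>
   differentiable_form c p (\<lambda>c q. \<theta> c q + \<eta> c q)"
  unfolding differentiable_form_def by (rule differentiable_add)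

lemma differentiable_form_scaleR:
  "differentiable_function c p f \<Longrightarrow> differentiable_form c p \<theta> \<Longrightarrow>
   differentiable_form c p (\<lambda>c q. f q *\<^sub>R \<theta> c q)"
  unfolding differentiable_form_def differentiable_function_def by (rule differentiable_scaleR)

section \<open>Rules for the exterior derivative\<close>

lemma ext_deriv_add:
  assumes "differentiable_form c p \<theta>" "differentiable_form c p \<eta>"
  shows "ext_deriv (\<lambda>c q. \<theta> c q + \<eta> c q) c p u v = ext_deriv \<theta> c p u v + ext_deriv \<eta> c p u v"
proof -
  have "frechet_derivative (\<lambda>x. \<theta> c (chart_inv c x) + \<eta> c (chart_inv c x)) (at (snd c p)) =
    (\<lambda>h. frechet_derivative (\<lambda>x. \<theta> c (chart_inv c x)) (at (snd c p)) h +
         frechet_derivative (\<lambda>x. \<eta> c (chart_inv c x)) (at (snd c p)) h)"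
    using assms unfolding differentiable_form_def
    by (intro frechet_derivative_at[symmetric] has_derivative_add)
      (simp_all add: frechet_derivative_works[symmetric])
  then show ?thesis by (simp add: ext_deriv_def blinfun.add_left)
qed

text \<open>Only at a pair of vectors annihilated by \<open>\<theta>\<close>, where the term \<open>df \<and> \<theta>\<close> vanishes.\<close>
lemma ext_deriv_scaleR:
  assumes "is_chart X c" "p \<in> fst c"
    and "differentiable_function c p f" "differentiable_form c p \<theta>"
    and "\<theta> c p u = 0" "\<theta> c p v = 0"
  shows "ext_deriv (\<lambda>c q. f q *\<^sub>R \<theta> c q) c p u v = f p * ext_deriv \<theta> c p u v"
proof -
  have "frechet_derivative (\<lambda>x. f (chart_inv c x) *\<^sub>R \<theta> c (chart_inv c x)) (at (snd c p)) =
    (\<lambda>h. f (chart_inv c (snd c p)) *\<^sub>R frechet_derivative (\<lambda>x. \<theta> c (chart_inv c x)) (at (snd c p)) h +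
         frechet_derivative (\<lambda>x. f (chart_inv c x)) (at (snd c p)) h *\<^sub>R \<theta> c (chart_inv c (snd c p)))"
    using assms(3,4) unfolding differentiable_form_def differentiable_function_def
    by (intro frechet_derivative_at[symmetric] has_derivative_scaleR)
      (simp_all add: frechet_derivative_works[symmetric])
  then show ?thesis using assms(5,6) chart_inv_chart[OF assms(1,2)]
    by (simp add: ext_deriv_def blinfun.add_left blinfun.scaleR_left algebra_simps)
qed

text \<open>The image of the chart domain is open, so the derivative at \<open>snd c p\<close>
  depends only on the values of the form on \<open>fst c\<close>. This lets pointwise identities on
  the manifold be differentiated although \<open>chart_inv c\<close> is unspecified off that
  image.\<close>

lemma ext_deriv_cong:
  assumes "is_chart X c" "p \<in> fst c" "differentiable_form c p \<theta>"
    and "\<And>q. q \<in> fst c \<Longrightarrow> \<theta> c q = \<eta> c q"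
  shows "ext_deriv \<theta> c p u v = ext_deriv \<eta> c p u v"
proof -
  have eq: "\<theta> c (chart_inv c x) = \<eta> c (chart_inv c x)" if "x \<in> snd c ` fst c" for x
    using that assms(1,4) chart_inv_chart by fastforce
  have "((\<lambda>x. \<theta> c (chart_inv c x)) has_derivative
      frechet_derivative (\<lambda>x. \<theta> c (chart_inv c x)) (at (snd c p))) (at (snd c p))"
    using assms(3) unfolding differentiable_form_def frechet_derivative_works .
  then have "((\<lambda>x. \<eta> c (chart_inv c x)) has_derivative
      frechet_derivative (\<lambda>x. \<theta> c (chart_inv c x)) (at (snd c p))) (at (snd c p))"
    by (rule has_derivative_transform_within_open[where s = "snd c ` fst c"])
      (use assms(1,2) eq in \<open>auto simp: is_chart_def\<close>)
  from frechet_derivative_at[OF this] show ?thesis by (simp add: ext_deriv_def)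
qed

section \<open>Dual bases of coframes\<close>

text \<open>Inner products identify covectors with vectors. The independent covectors then become a
  basis of the space, and each dual vector represents the functional that is 1 on one basis element
  and 0 on the others.\<close>

lemma dual_basis_exists:
  fixes w :: "'i \<Rightarrow> 'e::euclidean_space \<Rightarrow>\<^sub>L real"
  assumes "finite I" "inj_on w I" "independent (w ` I)" "card I = DIM('e)"
  obtains e where "\<And>i j. i \<in> I \<Longrightarrow> j \<in> I \<Longrightarrow> w i (e j) = (if i = j then 1 else 0)"
    and "\<And>v. v = (\<Sum>i\<in>I. w i v *\<^sub>R e i)"
proof -
  \<comment> \<open>\<open>T f\<close> is the Riesz representative of \<open>f\<close>.\<close>
  define T :: "('e \<Rightarrow>\<^sub>L real) \<Rightarrow> 'e" where "T f = (\<Sum>b\<in>Basis. f b *\<^sub>R b)" for f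
  have T: "f v = T f \<bullet> v" for f :: "'e \<Rightarrow>\<^sub>L real" and v
  proof -
    have "f v = f (\<Sum>b\<in>Basis. (v \<bullet> b) *\<^sub>R b)" by (simp add: euclidean_representation)
    also have "\<dots> = T f \<bullet> v"
      by (simp add: T_def blinfun.sum_right blinfun.scaleR_right inner_sum_left inner_commute[of v] mult.commute)
    finally show ?thesis .
  qed
  have linT: "linear T"
    by (rule linearI) (simp_all add: T_def blinfun.add_left blinfun.scaleR_left
        scaleR_add_left sum.distrib scaleR_sum_right)
  have injT: "inj T"
    by (rule injI) (metis T blinfun_eqI)
  define B where "B = T ` w ` I"
  have indB: "independent B"
    unfolding B_def using linear_independent_injective_image[OF linT assms(3)] injT
    by (metis inj_on_subset subset_UNIV)
  have injTw: "inj_on (\<lambda>i. T (w i)) I"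
    using assms(2) injT by (metis (mono_tags, lifting) inj_on_def injD)
  have "card B = card I" unfolding B_def image_image using injTw by (rule card_image)
  then have spanB: "span B = UNIV"
    using indB assms(4) by (metis card_ge_dim_independent dim_UNIV order_refl subset_UNIV top.extremum_uniqueI)
  have "\<exists>ej. \<forall>i\<in>I. T (w i) \<bullet> ej = (if i = j then 1 else 0)" for j
  proof -
    \<comment> \<open>The vector representing \<open>g\<close> is \<open>adjoint g 1\<close>. The
      conjunct \<open>j \<in> I\<close> handles an index outside \<open>I\<close>, whose covector
      may coincide with some \<open>w i\<close>.\<close>
    obtain g where g: "linear g" "\<And>x. x \<in> B \<Longrightarrow> g x = (if x = T (w j) \<and> j \<in> I then 1 else (0::real))"
      using linear_independent_extend[OF indB, of "\<lambda>x. if x = T (w j) \<and> j \<in> I then 1 else 0"] by blast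
    have "T (w i) \<bullet> adjoint g 1 = (if i = j then 1 else 0)" if "i \<in> I" for i
    proof -
      have "T (w i) \<bullet> adjoint g 1 = g (T (w i))"
        using adjoint_works[OF g(1), of "T (w i)" 1] by simp
      also have "\<dots> = (if i = j then 1 else 0)"
        using g(2)[of "T (w i)"] that injTw by (auto simp: B_def inj_on_def)
      finally show ?thesis .
    qed
    then show ?thesis by blast
  qed
  then obtain e where "\<And>j i. i \<in> I \<Longrightarrow> T (w i) \<bullet> e j = (if i = j then 1 else 0)" by metis
  then have e: "w i (e j) = (if i = j then 1 else 0)" if "i \<in> I" for i j
    using that by (simp add: T)
  have "v = (\<Sum>i\<in>I. w i v *\<^sub>R e i)" for v
  proof -
    \<comment> \<open>The error \<open>?d\<close> of the expansion is orthogonal to the spanning set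
      \<open>B\<close>, hence to itself.\<close>
    let ?d = "v - (\<Sum>i\<in>I. w i v *\<^sub>R e i)"
    have "w k ?d = 0" if "k \<in> I" for k
    proof -
      have "(\<Sum>i\<in>I. w i v * w k (e i)) = (\<Sum>i\<in>I. if k = i then w i v else 0)"
        using e[OF that] by (intro sum.cong) simp_all
      then show ?thesis using that assms(1)
        by (simp add: blinfun.diff_right blinfun.sum_right blinfun.scaleR_right)
    qed
    then have "\<And>x. x \<in> B \<Longrightarrow> x \<bullet> ?d = 0" unfolding B_def T by auto
    then have "?d \<bullet> ?d = 0"
      using spanB orthogonal_to_span[of ?d B ?d] by (auto simp: orthogonal_def inner_commute)
    then show ?thesis by simp
  qed
  with e show ?thesis using that by blast
qed

lemma sum_first_five:
  fixes f :: "nat \<Rightarrow> 'b::comm_monoid_add"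
  assumes "5 \<le> n" "\<And>i. i \<in> {6..n} \<Longrightarrow> f i = 0"
  shows "sum f {1..n} = f 1 + f 2 + f 3 + f 4 + f 5"
proof -
  have "sum f {1..n} = sum f {1..5}"
    by (rule sum.mono_neutral_right) (use assms in auto)
  also have "{1..5} = {1, 2, 3, 4, 5::nat}" by auto
  finally show ?thesis by (simp add: add.assoc)
qed

section \<open>The Goursat condition and the distribution \<open>Delta2\<close>\<close>

lemma goursat_det:
  fixes a :: "nat \<Rightarrow> nat \<Rightarrow> 'a \<Rightarrow> real"
  assumes "goursat_second_kind X a" "p \<in> topspace X"
  shows "(a 1 4 p - a 1 3 p) * (a 2 5 p - a 2 3 p) = (a 2 4 p - a 2 3 p) * (a 1 5 p - a 1 3 p)"
proof -
  have "det (vector [vector [1, 1, 1], vector [a 1 3 p, a 1 4 p, a 1 5 p],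
                     vector [a 2 3 p, a 2 4 p, a 2 5 p]] :: real^3^3) = 0"
    using assms unfolding goursat_second_kind_def by blast
  then show ?thesis unfolding det_3 vector_3 by (simp add: algebra_simps)
qed

text \<open>The coefficients of \<open>s\<close> are the cross product of \<open>(1, 1, 1)\<close> and \<open>(a\<^sub>1\<^sub>3, a\<^sub>1\<^sub>4, a\<^sub>1\<^sub>5)\<close>.\<close>
lemma pfaff_dist_Delta2_iff:
  assumes "5 \<le> n" "a 1 4 p \<noteq> a 1 3 p"
    and "(a 1 4 p - a 1 3 p) * (a 2 5 p - a 2 3 p) = (a 2 4 p - a 2 3 p) * (a 1 5 p - a 1 3 p)"
  shows "v \<in> pfaff_dist (Delta2 n \<omega> a) c p \<longleftrightarrow>
    (\<forall>\<sigma>\<in>{6..n}. \<omega> \<sigma> c p v = 0) \<and> \<omega> 2 c p v = - \<omega> 1 c p v \<and>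
    (\<exists>s. \<omega> 3 c p v = (a 1 5 p - a 1 4 p) * s \<and> \<omega> 4 c p v = (a 1 3 p - a 1 5 p) * s \<and>
         \<omega> 5 c p v = (a 1 4 p - a 1 3 p) * s)" (is "?L \<longleftrightarrow> ?R")
proof -
  let ?w = "\<lambda>i. \<omega> i c p v"
  have L: "?L \<longleftrightarrow> (\<forall>\<sigma>\<in>{6..n}. ?w \<sigma> = 0) \<and> ?w 1 + ?w 2 = 0 \<and> ?w 3 + ?w 4 + ?w 5 = 0 \<and>
     a 1 3 p * ?w 3 + a 1 4 p * ?w 4 + a 1 5 p * ?w 5 = 0 \<and>
     a 2 3 p * ?w 3 + a 2 4 p * ?w 4 + a 2 5 p * ?w 5 = 0"
    unfolding pfaff_dist_def Delta2_def
    by (auto simp: blinfun.add_left blinfun.scaleR_left)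
  show ?thesis
  proof
    assume ?L
    then have l: "\<forall>\<sigma>\<in>{6..n}. ?w \<sigma> = 0" "?w 1 + ?w 2 = 0" "?w 3 + ?w 4 + ?w 5 = 0"
      "a 1 3 p * ?w 3 + a 1 4 p * ?w 4 + a 1 5 p * ?w 5 = 0" using L by blast+
    \<comment> \<open>The parameter is read off from the fifth component, whose factor
      \<open>a 1 4 p - a 1 3 p\<close> is nonzero.\<close>
    define s where "s = ?w 5 / (a 1 4 p - a 1 3 p)"
    have 5: "?w 5 = (a 1 4 p - a 1 3 p) * s" using assms(2) by (simp add: s_def)
    have 3: "?w 3 = - ?w 4 - ?w 5" using l(3) by linarith
    have "(a 1 4 p - a 1 3 p) * ?w 4 = (a 1 4 p - a 1 3 p) * ((a 1 3 p - a 1 5 p) * s)"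
      using l(4) unfolding 3 5 by (simp add: algebra_simps)
    then have 4: "?w 4 = (a 1 3 p - a 1 5 p) * s" using assms(2) by simp
    have "?w 3 = (a 1 5 p - a 1 4 p) * s" unfolding 3 4 5 by (simp add: algebra_simps)
    then show ?R using 4 5 l by auto
  next
    assume ?R
    then obtain s where s: "?w 3 = (a 1 5 p - a 1 4 p) * s" "?w 4 = (a 1 3 p - a 1 5 p) * s"
         "?w 5 = (a 1 4 p - a 1 3 p) * s" by blast
    \<comment> \<open>The left side is \<open>s\<close> times the triple product of
      \<open>(1, 1, 1)\<close> and the two torsion rows, that is, \<open>s\<close> times the Goursat
      determinant.\<close>
    have "a 2 3 p * ?w 3 + a 2 4 p * ?w 4 + a 2 5 p * ?w 5 =
      s * ((a 1 4 p - a 1 3 p) * (a 2 5 p - a 2 3 p) - (a 2 4 p - a 2 3 p) * (a 1 5 p - a 1 3 p))"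
      unfolding s by (simp add: algebra_simps)
    also have "\<dots> = 0" using assms(3) by simp
    finally show ?L using \<open>?R\<close> unfolding L s by (simp add: algebra_simps)
  qed
qed

text \<open>A vector of the distribution is determined by \<open>x\<close>, its value under
  \<open>\<omega> 1\<close>, and the parameter \<open>s\<close>. Writing it in the dual basis gives
  an injective linear map from the plane onto the distribution.\<close>

lemma dim_pfaff_dist_Delta2:
  fixes \<omega> :: "nat \<Rightarrow> ('a, 'e::euclidean_space) form1"
  assumes "5 \<le> n" "DIM('e) = n" "a 1 4 p \<noteq> a 1 3 p"
    and "(a 1 4 p - a 1 3 p) * (a 2 5 p - a 2 3 p) = (a 2 4 p - a 2 3 p) * (a 1 5 p - a 1 3 p)"
    and "inj_on (\<lambda>\<xi>. \<omega> \<xi> c p) {1..n}" "independent ((\<lambda>\<xi>. \<omega> \<xi> c p) ` {1..n})"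
  shows "dim (pfaff_dist (Delta2 n \<omega> a) c p) = 2"
proof -
  obtain e where e: "\<And>i j. i \<in> {1..n} \<Longrightarrow> j \<in> {1..n} \<Longrightarrow> \<omega> i c p (e j) = (if i = j then 1 else 0)"
    and rep: "\<And>v. v = (\<Sum>i=1..n. \<omega> i c p v *\<^sub>R e i)"
    using dual_basis_exists[OF _ assms(5,6)] assms(2) by auto
  define F :: "real \<times> real \<Rightarrow> 'e" where
    "F = (\<lambda>(x, s). x *\<^sub>R e 1 + (- x) *\<^sub>R e 2 + ((a 1 5 p - a 1 4 p) * s) *\<^sub>R e 3 +
       ((a 1 3 p - a 1 5 p) * s) *\<^sub>R e 4 + ((a 1 4 p - a 1 3 p) * s) *\<^sub>R e 5)"
  have lin: "linear F"
    by (rule linearI) (auto simp: F_def algebra_simps)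
  have F: "\<omega> i c p (F (x, s)) = (if i = 1 then x else if i = 2 then - x
      else if i = 3 then (a 1 5 p - a 1 4 p) * s else if i = 4 then (a 1 3 p - a 1 5 p) * s
      else if i = 5 then (a 1 4 p - a 1 3 p) * s else 0)" if "i \<in> {1..n}" for i x s
    using that assms(1) by (simp add: F_def e blinfun.add_right blinfun.diff_right blinfun.minus_right
        blinfun.scaleR_right)
  have "inj F"
  proof (rule injI)
    fix y z assume eq: "F y = F z"
    obtain x s x' s' where yz: "y = (x, s)" "z = (x', s')" by fastforce
    \<comment> \<open>The first component recovers \<open>x\<close>, and the fifth recovers
      \<open>s\<close> because \<open>a 1 4 p \<noteq> a 1 3 p\<close>.\<close>
    have "\<omega> 1 c p (F (x, s)) = \<omega> 1 c p (F (x', s'))" "\<omega> 5 c p (F (x, s)) = \<omega> 5 c p (F (x', s'))"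
      using eq yz by simp_all
    then show "y = z" using assms(1,3) yz by (simp add: F)
  qed
  moreover have "pfaff_dist (Delta2 n \<omega> a) c p = range F"
  proof (intro equalityI subsetI)
    fix v assume "v \<in> pfaff_dist (Delta2 n \<omega> a) c p"
    then obtain s where s: "\<forall>\<sigma>\<in>{6..n}. \<omega> \<sigma> c p v = 0" "\<omega> 2 c p v = - \<omega> 1 c p v"
      "\<omega> 3 c p v = (a 1 5 p - a 1 4 p) * s" "\<omega> 4 c p v = (a 1 3 p - a 1 5 p) * s"
      "\<omega> 5 c p v = (a 1 4 p - a 1 3 p) * s"
      unfolding pfaff_dist_Delta2_iff[where a = a, OF assms(1,3,4)] by blast
    have "v = F (\<omega> 1 c p v, s)"
      by (subst rep, subst sum_first_five) (use assms(1) s in \<open>auto simp: F_def\<close>)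
    then show "v \<in> range F" by blast
  next
    fix v assume "v \<in> range F"
    then obtain x s where v: "v = F (x, s)" by auto
    show "v \<in> pfaff_dist (Delta2 n \<omega> a) c p"
      unfolding pfaff_dist_Delta2_iff[where a = a, OF assms(1,3,4)] v
      using assms(1) by (auto simp: F)
  qed
  ultimately show ?thesis using dim_image_eq[OF lin, of UNIV] by simp
qed

section \<open>The Frobenius condition for \<open>Delta2\<close>\<close>

theorem theorem8:
  fixes n :: nat
    and X :: "'a topology"
    and A :: "('a, 'e::euclidean_space) chart set"
    and \<omega> :: "nat \<Rightarrow> ('a, 'e) form1"
    and a :: "nat \<Rightarrow> nat \<Rightarrow> 'a \<Rightarrow> real"
  assumes "n \<ge> 5"
    and "smooth_manifold n X A"
    and "web n A \<omega>"
    and "torsion_tensor n A \<omega> a"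
    and "goursat_second_kind X a"
    and "goursat_nondegenerate X a"
    and "completely_integrable A 4 (Delta4 n \<omega> a)"
  shows "completely_integrable A 2 (Delta2 n \<omega> a)"
  unfolding completely_integrable_def
proof (intro ballI conjI)
  fix c p assume c: "c \<in> A" and p: "p \<in> fst c"
  have chart: "is_chart X c" and dim: "DIM('e) = n"
    using assms(2) c unfolding smooth_manifold_def by blast+
  have sub: "fst c \<subseteq> topspace X"
    using chart openin_subset unfolding is_chart_def by blast
  \<comment> \<open>Stated on the whole chart domain, since a relation between forms derived from it
    is differentiated below.\<close>
  have det: "(a 1 4 q - a 1 3 q) * (a 2 5 q - a 2 3 q) = (a 2 4 q - a 2 3 q) * (a 1 5 q - a 1 3 q)"
    if "q \<in> fst c" for q using goursat_det[OF assms(5)] sub that by blast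
  have "a 1 4 p - a 1 3 p \<noteq> 0"
    using assms(6) p sub unfolding goursat_nondegenerate_def
    by force
  then have nd: "a 1 4 p \<noteq> a 1 3 p" by simp
  note iff = pfaff_dist_Delta2_iff[where a = a, OF assms(1) nd det[OF p]]
  have "card {1..n} = n" "{1..n} \<subseteq> {1..n+1}" by auto
  then have "inj_on (\<lambda>\<xi>. \<omega> \<xi> c p) {1..n}" "independent ((\<lambda>\<xi>. \<omega> \<xi> c p) ` {1..n})"
    using assms(3) c p unfolding web_def by blast+
  then show "dim (pfaff_dist (Delta2 n \<omega> a) c p) = 2"
    using dim_pfaff_dist_Delta2[where a = a, OF assms(1) dim nd det[OF p]] by blast

  fix \<theta> u v
  assume \<theta>: "\<theta> \<in> Delta2 n \<omega> a" and u: "u \<in> pfaff_dist (Delta2 n \<omega> a) c p"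
    and v: "v \<in> pfaff_dist (Delta2 n \<omega> a) c p"

  obtain s where s: "\<forall>\<sigma>\<in>{6..n}. \<omega> \<sigma> c p u = 0" "\<omega> 2 c p u = - \<omega> 1 c p u"
      "\<omega> 3 c p u = (a 1 5 p - a 1 4 p) * s" "\<omega> 4 c p u = (a 1 3 p - a 1 5 p) * s"
      "\<omega> 5 c p u = (a 1 4 p - a 1 3 p) * s"
    using u unfolding iff by blast
  obtain t where t: "\<forall>\<sigma>\<in>{6..n}. \<omega> \<sigma> c p v = 0" "\<omega> 2 c p v = - \<omega> 1 c p v"
      "\<omega> 3 c p v = (a 1 5 p - a 1 4 p) * t" "\<omega> 4 c p v = (a 1 3 p - a 1 5 p) * t"
      "\<omega> 5 c p v = (a 1 4 p - a 1 3 p) * t"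
    using v unfolding iff by blast

  have tor: "\<forall>\<alpha>\<in>{1..n}. a \<alpha> \<alpha> p = 0" "\<forall>\<alpha>\<in>{1..n}. \<forall>\<beta>\<in>{1..n}. a \<alpha> \<beta> p = a \<beta> \<alpha> p"
    using assms(4) c p unfolding torsion_tensor_def by blast+
  obtain \<omega>0 where "\<forall>c\<in>A. \<forall>p\<in>fst c. \<forall>\<alpha>\<in>{1..n}. \<forall>u v. ext_deriv (\<omega> \<alpha>) c p u v =
           wedge (\<omega> \<alpha>) \<omega>0 c p u v +
           (\<Sum>\<beta>\<in>{1..n} - {\<alpha>}. a \<alpha> \<beta> p * wedge (\<omega> \<alpha>) (\<omega> \<beta>) c p u v)"
    using assms(4) unfolding torsion_tensor_def by (elim conjE exE)
  note \<omega>0 = this[rule_format, OF c p]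
  \<comment> \<open>The second factor of the structure equation: on vectors killed by
    \<open>\<omega> 6\<close>, ..., \<open>\<omega> n\<close> it reads \<open>d\<omega> \<alpha> =
    \<omega> \<alpha> \<and> \<phi> \<alpha>\<close>.\<close>
  define \<phi> where "\<phi> \<alpha> z = \<omega>0 c p z + a \<alpha> 1 p * \<omega> 1 c p z + a \<alpha> 2 p * \<omega> 2 c p z +
      a \<alpha> 3 p * \<omega> 3 c p z + a \<alpha> 4 p * \<omega> 4 c p z + a \<alpha> 5 p * \<omega> 5 c p z" for \<alpha> z
  have d: "ext_deriv (\<omega> \<alpha>) c p u v = \<omega> \<alpha> c p u * \<phi> \<alpha> v - \<omega> \<alpha> c p v * \<phi> \<alpha> u"
    if "\<alpha> \<in> {1..n}" for \<alpha>
  proof -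
    \<comment> \<open>The index \<open>\<beta> = \<alpha>\<close> may be included because the wedge
      of a form with itself is zero.\<close>
    have "ext_deriv (\<omega> \<alpha>) c p u v = wedge (\<omega> \<alpha>) \<omega>0 c p u v +
        (\<Sum>\<beta>=1..n. a \<alpha> \<beta> p * wedge (\<omega> \<alpha>) (\<omega> \<beta>) c p u v)"
      unfolding \<omega>0[OF that] using that by (simp add: sum.remove wedge_def)
    also have "\<dots> = \<omega> \<alpha> c p u * \<phi> \<alpha> v - \<omega> \<alpha> c p v * \<phi> \<alpha> u"
      by (subst sum_first_five[OF assms(1)])
        (use s(1) t(1) in \<open>simp_all add: wedge_def \<phi>_def algebra_simps\<close>)
    finally show ?thesis .
  qed
  have d\<sigma>: "ext_deriv (\<omega> \<sigma>) c p u v = 0" if "\<sigma> \<in> {6..n}" for \<sigma>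
    using d[of \<sigma>] s(1) t(1) that by simp

  have f: "differentiable_form c p (\<omega> i)" if "i \<in> {1..n}" for i
    using assms(3) that one_form_differentiable[OF _ c p] unfolding web_def by simp
  have g: "differentiable_function c p (a i j)" if "i \<in> {1..n}" "j \<in> {1..n}" for i j
    using assms(4) that smooth_function_differentiable[OF _ c p] unfolding torsion_tensor_def by blast
  note [simp] = differentiable_form_add differentiable_form_scaleR differentiable_function_diff
    differentiable_function_mult f g

  have inn: "1 \<in> {1..n}" "2 \<in> {1..n}" "3 \<in> {1..n}" "4 \<in> {1..n}" "5 \<in> {1..n}"
    using assms(1) by auto
  have sym: "a 2 1 p = a 1 2 p" "a 3 1 p = a 1 3 p" "a 4 1 p = a 1 4 p" "a 5 1 p = a 1 5 p"
    "a 3 2 p = a 2 3 p" "a 4 2 p = a 2 4 p" "a 5 2 p = a 2 5 p"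
    "a 4 3 p = a 3 4 p" "a 5 3 p = a 3 5 p" "a 5 4 p = a 4 5 p"
    using tor(2) inn by blast+
  have diag: "a 1 1 p = 0" "a 2 2 p = 0" "a 3 3 p = 0" "a 4 4 p = 0" "a 5 5 p = 0"
    using tor(1) inn by blast+

  define S :: "('a, 'e) form1" where "S = (\<lambda>c p. \<omega> 3 c p + \<omega> 4 c p + \<omega> 5 c p)"
  define H :: "nat \<Rightarrow> ('a, 'e) form1" where
    "H i = (\<lambda>c p. a i 3 p *\<^sub>R \<omega> 3 c p + a i 4 p *\<^sub>R \<omega> 4 c p + a i 5 p *\<^sub>R \<omega> 5 c p)" for i
  define K :: "('a, 'e) form1" where
    "K = (\<lambda>c p. (a 1 4 p - a 1 3 p) *\<^sub>R \<omega> 4 c p + (a 1 5 p - a 1 3 p) *\<^sub>R \<omega> 5 c p)"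
  have D2: "Delta2 n \<omega> a = {\<lambda>c p. \<omega> 1 c p + \<omega> 2 c p, S, H 1, H 2} \<union> \<omega> ` {6..n}"
    unfolding Delta2_def S_def H_def by simp
  have dS: "differentiable_form c p S" and dK: "differentiable_form c p K"
    and dH: "differentiable_form c p (H 1)" "differentiable_form c p (H 2)"
    unfolding S_def H_def K_def using inn by simp_all
  have zero: "S c p u = 0" "S c p v = 0" "H 1 c p u = 0" "H 1 c p v = 0"
    "H 2 c p u = 0" "H 2 c p v = 0"
    using u v unfolding pfaff_dist_def D2 by auto

  have \<phi>: "\<phi> i z = \<omega>0 c p z + a i 1 p * \<omega> 1 c p z + a i 2 p * \<omega> 2 c p z + H i c p z" for i z
    by (simp add: \<phi>_def H_def blinfun.add_left blinfun.scaleR_left)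
  \<comment> \<open>As \<open>H 1\<close> and \<open>H 2\<close> vanish on \<open>u\<close> and
    \<open>v\<close>, the sum is the wedge of \<open>\<omega> 1 + \<omega> 2\<close> with
    \<open>\<omega>0\<close> plus two terms in \<open>a 1 2\<close> that cancel by symmetry.\<close>
  have d12: "ext_deriv (\<lambda>c p. \<omega> 1 c p + \<omega> 2 c p) c p u v = 0"
    using inn by (simp add: ext_deriv_add d del: One_nat_def)
      (simp add: \<phi> zero s(2) t(2) sym diag algebra_simps del: One_nat_def)
  \<comment> \<open>The \<open>\<omega>0\<close> terms combine to the wedge of \<open>S\<close> with
    \<open>\<omega>0\<close>, and those in \<open>a 3 4\<close>, \<open>a 3 5\<close>,
    \<open>a 4 5\<close> cancel by symmetry. What remains is the sum of the wedges of
    \<open>H 1\<close> with \<open>\<omega> 1\<close> and of \<open>H 2\<close> with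
    \<open>\<omega> 2\<close>. In the parameters \<open>s\<close>, \<open>t\<close> it has the
    negative of the Goursat determinant as a factor.\<close>
  have "ext_deriv S c p u v = (s * \<omega> 1 c p v - t * \<omega> 1 c p u) *
      ((a 1 4 p - a 1 3 p) * (a 2 4 p - a 2 5 p) - (a 2 4 p - a 2 3 p) * (a 1 4 p - a 1 5 p))"
    unfolding S_def using inn
    by (simp add: ext_deriv_add d del: One_nat_def)
      (simp add: \<phi>_def s(2-5) t(2-5) sym diag algebra_simps del: One_nat_def)
  also have "\<dots> = 0" using det[OF p] by (simp add: algebra_simps)
  finally have d3: "ext_deriv S c p u v = 0" .

  have H1: "H 1 = (\<lambda>c p. K c p + a 1 3 p *\<^sub>R S c p)"
    by (intro ext) (simp add: H_def K_def S_def algebra_simps)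
  have "K c p u = 0" "K c p v = 0"
    using zero(1-4) unfolding H1 by (simp_all add: blinfun.add_left blinfun.scaleR_left)
  then have "u \<in> pfaff_dist (Delta4 n \<omega> a) c p" "v \<in> pfaff_dist (Delta4 n \<omega> a) c p"
    using s(1) t(1) unfolding pfaff_dist_def Delta4_def K_def by auto
  then have d4: "ext_deriv K c p u v = 0"
    using assms(7) c p unfolding completely_integrable_def Delta4_def K_def by blast

  \<comment> \<open>The product rule leaves only \<open>a 1 3 p\<close> times \<open>dS\<close>,
    because \<open>S\<close> vanishes on \<open>u\<close> and \<open>v\<close>.\<close>
  have d5: "ext_deriv (H 1) c p u v = 0"
    unfolding H1 using inn d3 d4 dS dK zero
    by (simp add: ext_deriv_add ext_deriv_scaleR[OF chart p])

  \<comment> \<open>The relation between \<open>H 2\<close>, \<open>H 1\<close> and \<open>S\<close>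
    is cleared of denominators, so that no quotient is differentiated; the factor is cancelled at
    \<open>p\<close> in the end.\<close>
  have "(a 1 4 p - a 1 3 p) * ext_deriv (H 2) c p u v =
      ext_deriv (\<lambda>c q. (a 1 4 q - a 1 3 q) *\<^sub>R H 2 c q) c p u v"
    using inn dH zero by (simp add: ext_deriv_scaleR[OF chart p])
  also have "\<dots> = ext_deriv (\<lambda>c q. (a 2 4 q - a 2 3 q) *\<^sub>R H 1 c q +
      ((a 1 4 q - a 1 3 q) * a 2 3 q - (a 2 4 q - a 2 3 q) * a 1 3 q) *\<^sub>R S c q) c p u v"
  proof (rule ext_deriv_cong[OF chart p])
    show "differentiable_form c p (\<lambda>c q. (a 1 4 q - a 1 3 q) *\<^sub>R H 2 c q)" using inn dH by simp
    fix q assume "q \<in> fst c"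
    \<comment> \<open>This is the coefficient of \<open>\<omega> 5\<close>, where the Goursat
      condition enters; those of \<open>\<omega> 3\<close> and \<open>\<omega> 4\<close> agree
      identically.\<close>
    have *: "(a 1 4 q - a 1 3 q) * a 2 5 q = (a 2 4 q - a 2 3 q) * a 1 5 q +
        ((a 1 4 q - a 1 3 q) * a 2 3 q - (a 2 4 q - a 2 3 q) * a 1 3 q)"
      using det[OF \<open>q \<in> fst c\<close>] by (simp add: algebra_simps)
    show "(a 1 4 q - a 1 3 q) *\<^sub>R H 2 c q = (a 2 4 q - a 2 3 q) *\<^sub>R H 1 c q +
      ((a 1 4 q - a 1 3 q) * a 2 3 q - (a 2 4 q - a 2 3 q) * a 1 3 q) *\<^sub>R S c q"
      unfolding H_def S_def scaleR_add_right scaleR_scaleR *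
      by (simp add: algebra_simps)
  qed
  also have "\<dots> = 0"
    using inn dH dS zero d3 d5 by (simp add: ext_deriv_add ext_deriv_scaleR[OF chart p])
  finally have d6: "ext_deriv (H 2) c p u v = 0" using nd by simp

  show "ext_deriv \<theta> c p u v = 0"
    using \<theta> d12 d3 d5 d6 d\<sigma> unfolding D2 by blast
qed

end
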